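(* Let $k,\ell\ge2$ be natural numbers and $\lambda>\aleph_0$ a cardinal. Then there exists a $(k,\ell)$-partition $G=(V,E_1,\dots,E_\ell)$ with $|V|=2^{\aleph_0}$ and an injective $\omega$-automatic presentation $(L,h)$ of $G$ such that there is no context-free $\omega$-language $H\subseteq L$ with $h(H)$ homogeneous in $G$ and of size $\lambda$; in particular there is no such regular $\omega$-language $H$.
   Context: For a set $V$ and $k\ge1$, $[V]^k$ is the set of $k$-element subsets of $V$. A $(k,\ell)$-partition is a tuple $(V,E_1,\dots,E_\ell)$ with $(E_1,\dots,E_\ell)$ a partition of $[V]^k$ into possibly empty sets; $W\subseteq V$ is homogeneous if $[W]^k\subseteq E_i$ for some $i$. A relation on $\omega$-words is $\omega$-automatic if the set of convolutions of its tuples (the $\omega$-words over the product alphabet read synchronously) is a regular $\omega$-language. An injective $\omega$-automatic presentation is a pair $(L,h)$ with $L$ a regular $\omega$-language and $h:L\to V$ a bijection such that $\{(x_1,\dots,x_k)\in L^k\mid\{h(x_1),\dots,h(x_k)\}\in E_i\}$ ($1\le i\le\ell$) and $\{(x,y)\in L^2\mid h(x)=h(y)\}$ are $\omega$-automatic. A context-free $\omega$-language is one accepted by a pushdown automaton with Büchi acceptance on states. *)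

theory Defs
  imports Main "HOL-Library.Omega_Words_Fun" "HOL-Library.Ramsey" "HOL-Library.Disjoint_Sets"
begin

unbundle cardinal_syntax

section \<open>Regular \<open>\<omega>\<close>-languages\<close>

record ('q, 'a) buchi =
  b_alphabet :: "'a set"
  b_states :: "'q set"
  b_initial :: "'q set"
  b_trans :: "('q \<times> 'a \<times> 'q) set"
  b_final :: "'q set"

definition buchi_automaton :: "('q, 'a) buchi \<Rightarrow> bool" where
  "buchi_automaton M \<longleftrightarrow>
     finite (b_alphabet M) \<and> finite (b_states M) \<and>
     b_initial M \<subseteq> b_states M \<and> b_final M \<subseteq> b_states M \<and>
     b_trans M \<subseteq> b_states M \<times> b_alphabet M \<times> b_states M"

definition buchi_run :: "('q, 'a) buchi \<Rightarrow> 'a word \<Rightarrow> 'q word \<Rightarrow> bool" where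
  "buchi_run M w r \<longleftrightarrow> r 0 \<in> b_initial M \<and> (\<forall>n. (r n, w n, r (Suc n)) \<in> b_trans M)"

definition buchi_language :: "('q, 'a) buchi \<Rightarrow> 'a word set" where
  "buchi_language M = {w. \<exists>r. buchi_run M w r \<and> limit r \<inter> b_final M \<noteq> {}}"

text \<open>State sets are finite, so drawing states from \<^typ>\<open>nat\<close> is no restriction; the same
  applies to states and stack symbols of pushdown automata below.\<close>

definition omega_regular :: "'a word set \<Rightarrow> bool" where
  "omega_regular L \<longleftrightarrow>
     (\<exists>M :: (nat, 'a) buchi. buchi_automaton M \<and> L = buchi_language M)"

section \<open>Context-free \<open>\<omega>\<close>-languages\<close>

text \<open>A transition \<open>(q, x, Z, q', \<alpha>)\<close> pops \<open>Z\<close> from the stack and pushes \<open>\<alpha>\<close>, whose first symbol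
  becomes the top; \<open>x = None\<close> is a silent move that reads no input.\<close>

record ('q, 'a, 'g) pda =
  p_alphabet :: "'a set"
  p_states :: "'q set"
  p_stack :: "'g set"
  p_initial :: 'q
  p_bottom :: 'g
  p_trans :: "('q \<times> 'a option \<times> 'g \<times> 'q \<times> 'g list) set"
  p_final :: "'q set"

definition pushdown_automaton :: "('q, 'a, 'g) pda \<Rightarrow> bool" where
  "pushdown_automaton M \<longleftrightarrow>
     finite (p_alphabet M) \<and> finite (p_states M) \<and> finite (p_stack M) \<and> finite (p_trans M) \<and>
     p_initial M \<in> p_states M \<and> p_bottom M \<in> p_stack M \<and> p_final M \<subseteq> p_states M \<and>
     p_trans M \<subseteq> p_states M \<times> (insert None (Some ` p_alphabet M)) \<times> p_stack M \<times>
                  p_states M \<times> lists (p_stack M)"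

text \<open>A configuration \<open>(q, i, \<gamma>)\<close> consists of the state, the number of input letters read so far
  and the stack (top first). There is no move from an empty stack.\<close>

inductive pda_step ::
  "('q, 'a, 'g) pda \<Rightarrow> 'a word \<Rightarrow> 'q \<times> nat \<times> 'g list \<Rightarrow> 'q \<times> nat \<times> 'g list \<Rightarrow> bool"
  for M w where
  read: "(q, Some (w i), Z, q', \<alpha>) \<in> p_trans M \<Longrightarrow>
         pda_step M w (q, i, Z # \<gamma>) (q', Suc i, \<alpha> @ \<gamma>)"
| silent: "(q, None, Z, q', \<alpha>) \<in> p_trans M \<Longrightarrow>
         pda_step M w (q, i, Z # \<gamma>) (q', i, \<alpha> @ \<gamma>)"

text \<open>The last conjunct excludes runs that from some point on make only silent moves and hence
  read just a finite prefix of the input.\<close>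

definition pda_run ::
  "('q, 'a, 'g) pda \<Rightarrow> 'a word \<Rightarrow> ('q \<times> nat \<times> 'g list) word \<Rightarrow> bool" where
  "pda_run M w r \<longleftrightarrow>
     r 0 = (p_initial M, 0, [p_bottom M]) \<and>
     (\<forall>n. pda_step M w (r n) (r (Suc n))) \<and>
     (\<forall>i. \<exists>n. i \<le> fst (snd (r n)))"

definition pda_language :: "('q, 'a, 'g) pda \<Rightarrow> 'a word set" where
  "pda_language M = {w. \<exists>r. pda_run M w r \<and> limit (fst \<circ> r) \<inter> p_final M \<noteq> {}}"

definition omega_context_free :: "'a word set \<Rightarrow> bool" where
  "omega_context_free L \<longleftrightarrow>
     (\<exists>M :: (nat, 'a, nat) pda. pushdown_automaton M \<and> L = pda_language M)"

section \<open>\<open>\<omega>\<close>-automatic relations\<close>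

text \<open>A \<open>k\<close>-ary relation is a set of lists of length \<open>k\<close>, and the \<open>k\<close>-fold product alphabet
  likewise consists of lists of length \<open>k\<close>.\<close>

definition convolution :: "'a word list \<Rightarrow> 'a list word" where
  "convolution xs = (\<lambda>n. map (\<lambda>x. x n) xs)"

definition omega_automatic :: "nat \<Rightarrow> 'a word list set \<Rightarrow> bool" where
  "omega_automatic k R \<longleftrightarrow> (\<forall>xs\<in>R. length xs = k) \<and> omega_regular (convolution ` R)"

section \<open>Partitions of \<open>k\<close>-element subsets and their presentations\<close>

text \<open>Only the classes \<open>E 1, \<dots>, E l\<close> of the family \<open>E\<close> are relevant.\<close>

definition kl_partition :: "nat \<Rightarrow> nat \<Rightarrow> 'v set \<Rightarrow> (nat \<Rightarrow> 'v set set) \<Rightarrow> bool" where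
  "kl_partition k l V E \<longleftrightarrow>
     (\<Union>i\<in>{1..l}. E i) = nsets V k \<and> disjoint_family_on E {1..l}"

definition homogeneous ::
  "nat \<Rightarrow> nat \<Rightarrow> 'v set \<Rightarrow> (nat \<Rightarrow> 'v set set) \<Rightarrow> 'v set \<Rightarrow> bool" where
  "homogeneous k l V E W \<longleftrightarrow> W \<subseteq> V \<and> (\<exists>i\<in>{1..l}. nsets W k \<subseteq> E i)"

definition injective_omega_automatic_presentation ::
  "nat \<Rightarrow> nat \<Rightarrow> 'v set \<Rightarrow> (nat \<Rightarrow> 'v set set) \<Rightarrow> 'a word set \<Rightarrow> ('a word \<Rightarrow> 'v) \<Rightarrow> bool" where
  "injective_omega_automatic_presentation k l V E L h \<longleftrightarrow>
     omega_regular L \<and> bij_betw h L V \<and>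
     (\<forall>i\<in>{1..l}. omega_automatic k {xs. length xs = k \<and> set xs \<subseteq> L \<and> h ` set xs \<in> E i}) \<and>
     omega_automatic 2 {[x, y] | x y. x \<in> L \<and> y \<in> L \<and> h x = h y}"

end

theory Submission
  imports Defs "HOL-Library.Countable_Set_Type"
begin

text \<open>Take all binary words, colour a \<open>k\<close>-set by \<open>1\<close> if its elements are pairwise eventually
  equal and by \<open>2\<close> otherwise. An uncountable context-free \<open>H\<close> contains a word that is not
  ultimately periodic. In an accepting run on it, some state and top stack symbol recur infinitely
  often at times after which the stack below is never touched. The factors of the word between
  these times can be permuted and repeated freely. They do not all commute with the first one,
  since the word would otherwise be ultimately periodic; so there are two factors \<open>y\<close>, \<open>z\<close> with
  \<open>v = yz \<noteq> zy = v'\<close>. Then \<open>u{v, v'}\<^sup>\<omega> \<subseteq> H\<close>, and as \<open>v\<close> and \<open>v'\<close> have the same length, this set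
  contains both infinitely many eventually equal words and words that are not eventually equal.\<close>

section \<open>Eventual equality is \<open>\<omega>\<close>-automatic\<close>

lemma buchi_language_iff:
  assumes "finite (b_final M)"
  shows "w \<in> buchi_language M \<longleftrightarrow> (\<exists>r. buchi_run M w r \<and> (\<exists>\<^sub>\<infinity>n. r n \<in> b_final M))"
  using fin_ex_inf_eq_limit[OF assms] by (auto simp: buchi_language_def)

text \<open>The automata below have sets and flags as states, whereas \<open>omega_regular\<close>
  asks for states in \<open>nat\<close>. An injection of the finite state set into
  \<open>nat\<close> renames them.\<close>

lemma omega_regular_buchi_language:
  fixes M :: "('q, 'a) buchi"
  assumes M: "buchi_automaton M"
  shows "omega_regular (buchi_language M)"
proof -
  have fin: "finite (b_states M)" "finite (b_final M)"
    using M finite_subset by (auto simp: buchi_automaton_def)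
  obtain f :: "'q \<Rightarrow> nat" where inj: "inj_on f (b_states M)"
    using finite_imp_inj_to_nat_seg[OF fin(1)] by blast
  define g where "g = inv_into (b_states M) f"
  have gf: "g (f q) = q" if "q \<in> b_states M" for q
    using that inj by (simp add: g_def)
  define N :: "(nat, 'a) buchi" where
    "N = \<lparr>b_alphabet = b_alphabet M, b_states = f ` b_states M, b_initial = f ` b_initial M,
          b_trans = (\<lambda>(q, a, q'). (f q, a, f q')) ` b_trans M, b_final = f ` b_final M\<rparr>"
  have sub: "b_initial M \<subseteq> b_states M" "b_final M \<subseteq> b_states M"
    "b_trans M \<subseteq> b_states M \<times> b_alphabet M \<times> b_states M"
    using M by (auto simp: buchi_automaton_def)
  have N: "buchi_automaton N"
    using M by (fastforce simp: buchi_automaton_def N_def)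
  have "w \<in> buchi_language M \<longleftrightarrow> w \<in> buchi_language N" for w
  proof
    assume "w \<in> buchi_language M"
    then obtain r where r: "buchi_run M w r" "\<exists>\<^sub>\<infinity>n. r n \<in> b_final M"
      using buchi_language_iff[OF fin(2)] by blast
    have "buchi_run N w (f \<circ> r)"
      using r(1) by (force simp: buchi_run_def N_def)
    moreover have "\<exists>\<^sub>\<infinity>n. (f \<circ> r) n \<in> b_final N"
      by (rule INFM_mono[OF r(2)]) (auto simp: N_def)
    ultimately show "w \<in> buchi_language N"
      using buchi_language_iff[of N] fin(2) by (auto simp: N_def)
  next
    assume "w \<in> buchi_language N"
    then obtain r where r: "buchi_run N w r" "\<exists>\<^sub>\<infinity>n. r n \<in> b_final N"
      using buchi_language_iff[of N] fin(2) by (auto simp: N_def)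
    have "buchi_run M w (g \<circ> r)"
      unfolding buchi_run_def
    proof (intro conjI allI)
      show "(g \<circ> r) 0 \<in> b_initial M"
        using r(1) sub gf by (force simp: buchi_run_def N_def)
      fix n
      have "(r n, w n, r (Suc n)) \<in> b_trans N"
        using r(1) by (auto simp: buchi_run_def)
      then obtain q q' where q: "r n = f q" "r (Suc n) = f q'" "(q, w n, q') \<in> b_trans M"
        by (auto simp: N_def)
      then show "((g \<circ> r) n, w n, (g \<circ> r) (Suc n)) \<in> b_trans M"
        using sub(3) gf by auto
    qed
    moreover have "\<exists>\<^sub>\<infinity>n. (g \<circ> r) n \<in> b_final M"
      by (rule INFM_mono[OF r(2)]) (use sub gf in \<open>auto simp: N_def\<close>)
    ultimately show "w \<in> buchi_language M"
      using buchi_language_iff[OF fin(2)] by blast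
  qed
  then show ?thesis
    unfolding omega_regular_def using N by blast
qed

lemma omega_regular_words:
  assumes "finite A"
  shows "omega_regular {w. \<forall>n. w n \<in> A}"
proof -
  define M :: "(unit, 'a) buchi" where
    "M = \<lparr>b_alphabet = A, b_states = UNIV, b_initial = UNIV,
          b_trans = UNIV \<times> A \<times> UNIV, b_final = UNIV\<rparr>"
  have "buchi_automaton M"
    using assms by (simp add: buchi_automaton_def M_def)
  moreover have "buchi_language M = {w. \<forall>n. w n \<in> A}"
    by (auto simp: buchi_language_iff M_def buchi_run_def)
  ultimately show ?thesis
    using omega_regular_buchi_language by metis
qed

lemma omega_regular_empty: "omega_regular {}"
  using omega_regular_words[of "{}"] by simp

text \<open>The Boolean component of a state is the automaton's guess that \<open>d\<close> is empty on all letters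
  still to come.\<close>

lemma omega_regular_Union_MOST_empty:
  fixes d :: "'a \<Rightarrow> 'b set"
  assumes "finite A" "finite F" and d: "\<And>a. a \<in> A \<Longrightarrow> d a \<subseteq> F"
  shows "omega_regular {w. (\<forall>n. w n \<in> A) \<and> (\<Union>n. d (w n)) = F \<and> (\<forall>\<^sub>\<infinity>n. d (w n) = {})}"
    (is "omega_regular ?L")
proof -
  define M :: "('b set \<times> bool, 'a) buchi" where
    "M = \<lparr>b_alphabet = A, b_states = Pow F \<times> UNIV, b_initial = {({}, False)},
          b_trans = {((D, b), a, (D \<union> d a, b')) | D b a b'.
                       D \<subseteq> F \<and> a \<in> A \<and> (b \<longrightarrow> b' \<and> d a = {})},
          b_final = {(F, True)}\<rparr>"
  have "buchi_automaton M"
    using assms by (auto simp: buchi_automaton_def M_def dest: d)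
  moreover have "buchi_language M = ?L"
  proof (intro set_eqI iffI)
    fix w assume "w \<in> buchi_language M"
    then obtain r where r0: "r 0 = ({}, False)" and inf: "\<exists>\<^sub>\<infinity>n. r n = (F, True)"
      and r: "\<And>n. (r n, w n, r (Suc n)) \<in> b_trans M"
      by (auto simp: buchi_language_iff buchi_run_def M_def)
    have A: "w n \<in> A" for n
      using r[of n] by (auto simp: M_def)
    have D: "fst (r n) = (\<Union>m<n. d (w m))" for n
    proof (induction n)
      case (Suc n)
      then show ?case using r[of n] by (auto simp: M_def lessThan_Suc)
    qed (simp add: r0)
    obtain N where N: "r N = (F, True)"
      using inf INFM_EX by blast
    have flag: "snd (r (N + n))" for n
    proof (induction n)
      case (Suc n)
      then show ?case using r[of "N + n"] by (auto simp: M_def)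
    qed (simp add: N)
    have "d (w n) = {}" if "N \<le> n" for n
      using flag[of "n - N"] r[of n] that by (auto simp: M_def)
    then have "\<forall>\<^sub>\<infinity>n. d (w n) = {}"
      unfolding MOST_nat_le by blast
    moreover have "(\<Union>n. d (w n)) = F"
      using D[of N] N A d by auto
    ultimately show "w \<in> ?L"
      using A by blast
  next
    fix w assume w: "w \<in> ?L"
    then obtain N where N: "\<And>n. N \<le> n \<Longrightarrow> d (w n) = {}"
      unfolding MOST_nat_le by blast
    \<comment> \<open>The initial state carries the flag False, so the guess cannot be made at time
      0, even when \<open>N = 0\<close>.\<close>
    define N' where "N' = Suc N"
    define r where "r n = ((\<Union>m<n. d (w m)), N' \<le> n)" for n
    have "\<exists>\<^sub>\<infinity>n. r n \<in> b_final M"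
      unfolding INFM_nat_le
    proof
      fix n
      have "(\<Union>m. d (w m)) \<subseteq> (\<Union>m<max n N'. d (w m))"
      proof
        fix x assume "x \<in> (\<Union>m. d (w m))"
        then obtain m where m: "x \<in> d (w m)" by blast
        then have "m < max n N'"
          using N[of m] by (fastforce simp: N'_def)
        then show "x \<in> (\<Union>m<max n N'. d (w m))"
          using m by blast
      qed
      then have "(\<Union>m<max n N'. d (w m)) = F"
        using w by blast
      then show "\<exists>m\<ge>n. r m \<in> b_final M"
        by (intro exI[of _ "max n N'"]) (simp add: r_def M_def)
    qed
    moreover have "buchi_run M w r"
    proof -
      have "(\<Union>m<n. d (w m)) \<subseteq> F" for n
        using w by blast
      then show ?thesis
        using w N by (fastforce simp: buchi_run_def M_def r_def lessThan_Suc Un_commute N'_def)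
    qed
    ultimately show "w \<in> buchi_language M"
      using buchi_language_iff[of M] by (auto simp: M_def)
  qed
  ultimately show ?thesis
    using omega_regular_buchi_language by metis
qed

text \<open>Instead of a guess, the flag records whether \<open>d\<close> was nonempty on the letter
  just read. The set component only grows, so after it has reached \<open>F\<close> each visit to
  the final state witnesses a further nonempty letter.\<close>

lemma omega_regular_Union_INFM_nonempty:
  fixes d :: "'a \<Rightarrow> 'b set"
  assumes "finite A" "finite F" and d: "\<And>a. a \<in> A \<Longrightarrow> d a \<subseteq> F"
  shows "omega_regular {w. (\<forall>n. w n \<in> A) \<and> (\<Union>n. d (w n)) = F \<and> (\<exists>\<^sub>\<infinity>n. d (w n) \<noteq> {})}"
    (is "omega_regular ?L")
proof -
  define M :: "('b set \<times> bool, 'a) buchi" where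
    "M = \<lparr>b_alphabet = A, b_states = Pow F \<times> UNIV, b_initial = {({}, False)},
          b_trans = {((D, b), a, (D \<union> d a, d a \<noteq> {})) | D b a. D \<subseteq> F \<and> a \<in> A},
          b_final = {(F, True)}\<rparr>"
  have "buchi_automaton M"
    using assms by (auto simp: buchi_automaton_def M_def dest: d)
  moreover have "buchi_language M = ?L"
  proof (intro set_eqI iffI)
    fix w assume "w \<in> buchi_language M"
    then obtain r where r0: "r 0 = ({}, False)" and inf: "\<exists>\<^sub>\<infinity>n. r n = (F, True)"
      and r: "\<And>n. (r n, w n, r (Suc n)) \<in> b_trans M"
      by (auto simp: buchi_language_iff buchi_run_def M_def)
    have A: "w n \<in> A" for n
      using r[of n] by (auto simp: M_def)
    have D: "fst (r n) = (\<Union>m<n. d (w m))" for n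
    proof (induction n)
      case (Suc n)
      then show ?case using r[of n] by (auto simp: M_def lessThan_Suc)
    qed (simp add: r0)
    \<comment> \<open>The flag at time \<open>m\<close> reports on letter \<open>m - 1\<close>,
      hence a visit strictly after \<open>n\<close> is chosen.\<close>
    have "\<exists>m\<ge>n. d (w m) \<noteq> {}" for n
    proof -
      obtain m where m: "m > n" "r m = (F, True)"
        using inf unfolding INFM_nat by blast
      then obtain m' where "m = Suc m'"
        using gr0_implies_Suc by fastforce
      then show ?thesis
        using m r[of m'] by (auto simp: M_def)
    qed
    then have "\<exists>\<^sub>\<infinity>n. d (w n) \<noteq> {}"
      unfolding INFM_nat_le by blast
    moreover obtain N where N: "r N = (F, True)"
      using inf INFM_EX by blast
    then have "(\<Union>n. d (w n)) = F"
      using D[of N] A d by auto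
    ultimately show "w \<in> ?L"
      using A by blast
  next
    fix w assume w: "w \<in> ?L"
    define r where "r n = ((\<Union>m<n. d (w m)), n > 0 \<and> d (w (n - 1)) \<noteq> {})" for n
    have "\<forall>x\<in>F. \<exists>m. x \<in> d (w m)"
      using w by blast
    then obtain j where j: "\<And>x. x \<in> F \<Longrightarrow> x \<in> d (w (j x))"
      by metis
    \<comment> \<open>As \<open>F\<close> is finite, the chosen positions \<open>j x\<close> have a
      common bound, beyond which the set component stays equal to \<open>F\<close>.\<close>
    obtain N where N: "\<And>x. x \<in> F \<Longrightarrow> j x < N"
      using finite_nat_set_iff_bounded[of "j ` F"] \<open>finite F\<close> by auto
    have "\<exists>\<^sub>\<infinity>n. r n \<in> b_final M"
      unfolding INFM_nat_le
    proof
      fix n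
      obtain m where m: "m \<ge> max n N" "d (w m) \<noteq> {}"
        using w unfolding INFM_nat_le by blast
      have "F \<subseteq> (\<Union>i<Suc m. d (w i))"
      proof
        fix x assume "x \<in> F"
        then show "x \<in> (\<Union>i<Suc m. d (w i))"
          using j[of x] N[of x] m by (intro UN_I[of "j x"]) auto
      qed
      then have "(\<Union>i<Suc m. d (w i)) = F"
        using w by blast
      then show "\<exists>m\<ge>n. r m \<in> b_final M"
        using m by (intro exI[of _ "Suc m"]) (simp add: r_def M_def)
    qed
    moreover have "buchi_run M w r"
    proof -
      have "(\<Union>m<n. d (w m)) \<subseteq> F" for n
        using w by blast
      then show ?thesis
        using w by (fastforce simp: buchi_run_def M_def r_def lessThan_Suc Un_commute)
    qed
    ultimately show "w \<in> buchi_language M"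
      using buchi_language_iff[of M] by (auto simp: M_def)
  qed
  ultimately show ?thesis
    using omega_regular_buchi_language by metis
qed

text \<open>Every word over letters of length \<open>k\<close> is the convolution of its
  \<open>k\<close> tracks. This turns a condition \<open>Q\<close> on convolutions into a language
  to which the two automata above apply.\<close>

lemma convolution_image:
  "convolution ` {xs. length xs = k \<and> (\<forall>x\<in>set xs. \<forall>n. x n \<in> A) \<and> Q (convolution xs)} =
   {w. (\<forall>n. w n \<in> {a. length a = k \<and> set a \<subseteq> A}) \<and> Q w}" (is "convolution ` ?X = ?W")
proof
  show "convolution ` ?X \<subseteq> ?W"
    by (auto simp: convolution_def)
  show "?W \<subseteq> convolution ` ?X"
  proof
    fix w assume w: "w \<in> ?W"
    define xs where "xs = map (\<lambda>i n. w n ! i) [0..<k]"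
    have len: "length (w n) = k" for n
      using w by auto
    have conv: "convolution xs = w"
      by (rule ext, rule nth_equalityI) (auto simp: convolution_def xs_def len)
    moreover have "w n ! i \<in> A" if "i < k" for i n
      using w that nth_mem[of i "w n"] len[of n] by (auto simp del: nth_mem)
    ultimately have "xs \<in> ?X"
      using w by (auto simp: xs_def)
    then show "w \<in> convolution ` ?X"
      using conv by blast
  qed
qed

section \<open>The partition by eventual equality and its presentation\<close>

definition eventually_equal :: "'a word \<Rightarrow> 'a word \<Rightarrow> bool" where
  "eventually_equal x y \<longleftrightarrow> (\<forall>\<^sub>\<infinity>n. x n = y n)"

text \<open>All classes past the second are empty, so one definition serves every
  \<open>l \<ge> 2\<close>.\<close>

definition ee_class :: "'a word set \<Rightarrow> nat \<Rightarrow> nat \<Rightarrow> 'a word set set" where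
  "ee_class V k i =
     (if i = 1 then {S \<in> nsets V k. \<forall>x\<in>S. \<forall>y\<in>S. eventually_equal x y}
      else if i = 2 then {S \<in> nsets V k. \<exists>x\<in>S. \<exists>y\<in>S. \<not> eventually_equal x y}
      else {})"

lemma kl_partition_ee_class:
  assumes "l \<ge> 2"
  shows "kl_partition k l V (ee_class V k)"
proof -
  have "(\<Union>i\<in>{1..l}. ee_class V k i) = nsets V k"
  proof
    show "nsets V k \<subseteq> (\<Union>i\<in>{1..l}. ee_class V k i)"
    proof
      fix S assume S: "S \<in> nsets V k"
      then have "S \<in> ee_class V k 1 \<or> S \<in> ee_class V k 2"
        by (auto simp: ee_class_def)
      then show "S \<in> (\<Union>i\<in>{1..l}. ee_class V k i)"
        using assms by (metis UN_I atLeastAtMost_iff le_refl one_le_numeral le_trans)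
    qed
  qed (auto simp: ee_class_def)
  moreover have "disjoint_family_on (ee_class V k) {1..l}"
    by (auto simp: disjoint_family_on_def ee_class_def)
  ultimately show ?thesis
    by (simp add: kl_partition_def)
qed

text \<open>This depends on a single letter, so it can be the map \<open>d\<close> of the two
  automata.\<close>

definition differing :: "nat \<Rightarrow> 'a list \<Rightarrow> (nat \<times> nat) set" where
  "differing k a = {(i, j). i < k \<and> j < k \<and> a ! i \<noteq> a ! j}"

lemma differing_convolution:
  assumes "length xs = k"
  shows "differing k (convolution xs n) = {(i, j). i < k \<and> j < k \<and> (xs ! i) n \<noteq> (xs ! j) n}"
  using assms by (auto simp: differing_def convolution_def)

text \<open>A list with repetitions has fewer than \<open>k\<close> elements, so its set lies in no
  class and the automata have to reject it. A pair of tracks enters the union exactly when its words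
  differ somewhere.\<close>

lemma Union_differing_convolution:
  assumes "length xs = k"
  shows "(\<Union>n. differing k (convolution xs n)) = {(i, j). i < k \<and> j < k \<and> i \<noteq> j} \<longleftrightarrow>
         card (set xs) = k"
proof -
  have "(\<Union>n. differing k (convolution xs n)) = {(i, j). i < k \<and> j < k \<and> xs ! i \<noteq> xs ! j}"
    by (auto simp: differing_convolution[OF assms] fun_eq_iff)
  moreover have "card (set xs) = k \<longleftrightarrow> distinct xs"
    using assms card_distinct[of xs] distinct_card[of xs] by auto
  ultimately show ?thesis
    using assms by (auto simp: distinct_conv_nth set_eq_iff)
qed

text \<open>There are finitely many pairs of tracks, so "almost always" commutes with quantification
  over them.\<close>

lemma MOST_differing_convolution:
  assumes "length xs = k"
  shows "(\<forall>\<^sub>\<infinity>n. differing k (convolution xs n) = {}) \<longleftrightarrow>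
         (\<forall>x\<in>set xs. \<forall>y\<in>set xs. eventually_equal x y)"
proof -
  have "differing k (convolution xs n) = {} \<longleftrightarrow> (\<forall>x\<in>set xs. \<forall>y\<in>set xs. x n = y n)" for n
    using assms by (simp add: differing_convolution all_set_conv_all_nth) blast
  then show ?thesis
    by (simp add: eventually_equal_def eventually_ball_finite_distrib)
qed

lemma omega_automatic_ee_class:
  fixes A :: "'a set"
  assumes "finite A" and L: "L = {w. \<forall>n. w n \<in> A}"
  shows "omega_automatic k {xs. length xs = k \<and> set xs \<subseteq> L \<and> set xs \<in> ee_class L k i}"
    (is "omega_automatic k ?R")
proof -
  let ?A = "{a. length a = k \<and> set a \<subseteq> A}"
  let ?F = "{(i, j). i < k \<and> j < k \<and> i \<noteq> j}"
  have finA: "finite ?A"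
    using finite_lists_length_eq[OF \<open>finite A\<close>, of k] by (simp add: conj_commute)
  have finF: "finite ?F"
    by (rule finite_subset[of _ "{..<k} \<times> {..<k}"]) auto
  have sub: "differing k a \<subseteq> ?F" for a :: "'a list"
    by (auto simp: differing_def)
  consider "i = 1" | "i = 2" | "i \<noteq> 1" "i \<noteq> 2" by blast
  then have "omega_regular (convolution ` ?R)"
  proof cases
    case 1
    define Q where "Q w \<longleftrightarrow> (\<Union>n. differing k (w n)) = ?F \<and> (\<forall>\<^sub>\<infinity>n. differing k (w n) = {})"
      for w :: "'a list word"
    have "Q (convolution xs) \<longleftrightarrow>
        card (set xs) = k \<and> (\<forall>x\<in>set xs. \<forall>y\<in>set xs. eventually_equal x y)"
      if "length xs = k" for xs :: "'a word list"
      unfolding Q_def Union_differing_convolution[OF that] MOST_differing_convolution[OF that] ..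
    then have "?R = {xs. length xs = k \<and> (\<forall>x\<in>set xs. \<forall>n. x n \<in> A) \<and> Q (convolution xs)}"
      by (intro Collect_cong) (auto simp: 1 ee_class_def nsets_def L)
    then have "convolution ` ?R = {w. (\<forall>n. w n \<in> ?A) \<and> Q w}"
      by (simp only: convolution_image)
    then show ?thesis
      using omega_regular_Union_MOST_empty[of ?A ?F "differing k", OF finA finF sub]
      by (simp only: Q_def)
  next
    case 2
    define Q where "Q w \<longleftrightarrow> (\<Union>n. differing k (w n)) = ?F \<and> (\<exists>\<^sub>\<infinity>n. differing k (w n) \<noteq> {})"
      for w :: "'a list word"
    have "Q (convolution xs) \<longleftrightarrow>
        card (set xs) = k \<and> \<not> (\<forall>x\<in>set xs. \<forall>y\<in>set xs. eventually_equal x y)"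
      if "length xs = k" for xs :: "'a word list"
    proof -
      have "(\<exists>\<^sub>\<infinity>n. differing k (convolution xs n) \<noteq> {}) \<longleftrightarrow>
          \<not> (\<forall>\<^sub>\<infinity>n. differing k (convolution xs n) = {})"
        by simp
      then show ?thesis
        unfolding Q_def Union_differing_convolution[OF that] MOST_differing_convolution[OF that]
        by (rule arg_cong)
    qed
    then have "?R = {xs. length xs = k \<and> (\<forall>x\<in>set xs. \<forall>n. x n \<in> A) \<and> Q (convolution xs)}"
      by (intro Collect_cong) (auto simp: 2 ee_class_def nsets_def L)
    then have "convolution ` ?R = {w. (\<forall>n. w n \<in> ?A) \<and> Q w}"
      by (simp only: convolution_image)
    then show ?thesis
      using omega_regular_Union_INFM_nonempty[of ?A ?F "differing k", OF finA finF sub]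
      by (simp only: Q_def)
  next
    case 3
    then show ?thesis
      by (simp add: ee_class_def omega_regular_empty)
  qed
  then show ?thesis
    by (auto simp: omega_automatic_def)
qed

lemma omega_automatic_equality:
  assumes "finite A"
  shows "omega_automatic 2 {[x, y] | x y. (\<forall>n. x n \<in> A) \<and> (\<forall>n. y n \<in> A) \<and> x = y}"
    (is "omega_automatic 2 ?R")
proof -
  have "convolution ` ?R = {w. \<forall>n. w n \<in> (\<lambda>a. [a, a]) ` A}" (is "_ = ?W")
  proof
    show "?W \<subseteq> convolution ` ?R"
    proof
      fix w assume w: "w \<in> ?W"
      define x where "x n = hd (w n)" for n
      have "x n \<in> A \<and> w n = [x n, x n]" for n
      proof -
        have "w n \<in> (\<lambda>a. [a, a]) ` A"
          using w by blast
        then show ?thesis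
          by (auto simp: x_def)
      qed
      then have "w = convolution [x, x]" "\<forall>n. x n \<in> A"
        by (auto simp: convolution_def)
      then show "w \<in> convolution ` ?R" by blast
    qed
  qed (auto simp: convolution_def)
  then show ?thesis
    using omega_regular_words[of "(\<lambda>a. [a, a]) ` A"] assms
    by (auto simp: omega_automatic_def)
qed

lemma presentation_ee_class:
  assumes "finite A" and L: "L = {w. \<forall>n. w n \<in> A}"
  shows "injective_omega_automatic_presentation k l L (ee_class L k) L id"
  using omega_automatic_ee_class[OF assms, of k] omega_automatic_equality[OF assms(1)]
    omega_regular_words[OF assms(1)]
  by (simp add: injective_omega_automatic_presentation_def L)

lemma card_of_binary_words:
  "|{w :: nat word. \<forall>n. w n \<in> {0, 1}}| =o ctwo ^c natLeq"
proof -
  let ?f = "\<lambda>w n. w n = (1::nat)"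
  have "bij_betw ?f {w :: nat word. \<forall>n. w n \<in> {0, 1}} (Func UNIV (UNIV :: bool set))"
  proof (rule bij_betwI[where g = "\<lambda>b n. if b n then 1 else 0"])
  qed (auto simp: Func_def fun_eq_iff)
  then have "|{w :: nat word. \<forall>n. w n \<in> {0, 1}}| =o |Func (UNIV :: nat set) (UNIV :: bool set)|"
    by (rule card_of_ordIsoI)
  then show ?thesis
    by (simp add: cexp_def ctwo_def Field_card_of Field_natLeq)
qed

section \<open>Pumping for pushdown automata\<close>

text \<open>A path mentions no position in a fixed input word, so its label can be moved elsewhere.
  The flag tells whether some step starts in a final state; the last configuration is left to the
  path that continues it.\<close>

inductive pda_path ::
  "('q, 'a, 'g) pda \<Rightarrow> bool \<Rightarrow> 'q \<times> 'g list \<Rightarrow> 'a list \<Rightarrow> 'q \<times> 'g list \<Rightarrow> bool" for M where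
  empty: "pda_path M False c [] c"
| read: "(q, Some a, Z, q', \<alpha>) \<in> p_trans M \<Longrightarrow> pda_path M b (q', \<alpha> @ \<gamma>) xs c \<Longrightarrow>
         pda_path M (b \<or> q \<in> p_final M) (q, Z # \<gamma>) (a # xs) c"
| silent: "(q, None, Z, q', \<alpha>) \<in> p_trans M \<Longrightarrow> pda_path M b (q', \<alpha> @ \<gamma>) xs c \<Longrightarrow>
         pda_path M (b \<or> q \<in> p_final M) (q, Z # \<gamma>) xs c"

lemma pda_path_append:
  "pda_path M b c xs c' \<Longrightarrow> pda_path M b' c' ys c'' \<Longrightarrow> pda_path M (b \<or> b') c (xs @ ys) c''"
proof (induction rule: pda_path.induct)
  case (read q a Z q' \<alpha> b \<gamma> xs c)
  then show ?case
    using pda_path.read[OF read(1), of "b \<or> b'" \<gamma> "xs @ ys" c''] by (simp add: disj_ac)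
next
  case (silent q Z q' \<alpha> b \<gamma> xs c)
  then show ?case
    using pda_path.silent[OF silent(1), of "b \<or> b'" \<gamma> "xs @ ys" c''] by (simp add: disj_ac)
qed simp

text \<open>A step looks only at the top symbol, so a path can be replayed above any stack. This is
  what makes loops on a top symbol repeatable.\<close>

lemma pda_path_frame:
  "pda_path M b c xs c' \<Longrightarrow>
   pda_path M b (fst c, snd c @ \<gamma>) xs (fst c', snd c' @ \<gamma>)"
  by (induction rule: pda_path.induct) (auto intro: pda_path.intros)

text \<open>Puts a path back into an input word \<open>x\<close> that carries its label from
  position \<open>i\<close> on. The number \<open>l\<close> of steps is kept apart from
  \<open>length xs\<close>, because silent moves read nothing.\<close>

lemma pda_path_steps:
  assumes "pda_path M b c xs c'"
    and "\<And>m. m < length xs \<Longrightarrow> x (i + m) = xs ! m"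
  shows "\<exists>l p. p 0 = (fst c, i, snd c) \<and> p l = (fst c', i + length xs, snd c') \<and>
           (\<forall>j<l. pda_step M x (p j) (p (Suc j))) \<and>
           (b \<longrightarrow> (\<exists>j<l. fst (p j) \<in> p_final M))"
  using assms
proof (induction arbitrary: i rule: pda_path.induct)
  case (empty c)
  show ?case
    by (intro exI[of _ 0] exI[of _ "\<lambda>_. (fst c, i, snd c)"]) simp
next
  case (read q a Z q' \<alpha> b \<gamma> xs c)
  have "x (Suc i + m) = xs ! m" if "m < length xs" for m
    using read.prems[of "Suc m"] that by simp
  then obtain l p where p: "p 0 = (q', Suc i, \<alpha> @ \<gamma>)"
      "p l = (fst c, Suc i + length xs, snd c)"
      "\<forall>j<l. pda_step M x (p j) (p (Suc j))" "b \<longrightarrow> (\<exists>j<l. fst (p j) \<in> p_final M)"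
    using read.IH[of "Suc i"] by auto
  have "pda_step M x (q, i, Z # \<gamma>) (p 0)"
    using read.hyps(1) read.prems[of 0] pda_step.read[of q x i Z q' \<alpha> M \<gamma>] p(1) by simp
  then show ?case
    using p
    by (intro exI[of _ "Suc l"] exI[of _ "case_nat (q, i, Z # \<gamma>) p"])
      (auto simp: less_Suc_eq_0_disj)
next
  case (silent q Z q' \<alpha> b \<gamma> xs c)
  then obtain l p where p: "p 0 = (q', i, \<alpha> @ \<gamma>)" "p l = (fst c, i + length xs, snd c)"
      "\<forall>j<l. pda_step M x (p j) (p (Suc j))" "b \<longrightarrow> (\<exists>j<l. fst (p j) \<in> p_final M)"
    by (metis fst_conv snd_conv)
  have "pda_step M x (q, i, Z # \<gamma>) (p 0)"
    using silent.hyps(1) pda_step.silent[of q Z q' \<alpha> M x i \<gamma>] p(1) by simp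
  then show ?case
    using p
    by (intro exI[of _ "Suc l"] exI[of _ "case_nat (q, i, Z # \<gamma>) p"])
      (auto simp: less_Suc_eq_0_disj)
qed

text \<open>Each piece ends where the next one begins. A visit to \<open>F\<close> before the end of
  each piece makes the piece nonempty and yields infinitely many visits in the glued
  sequence.\<close>

lemma glue_paths:
  fixes R :: "'c \<Rightarrow> 'c \<Rightarrow> bool"
  assumes "\<And>i. \<exists>l p. p 0 = c i \<and> p l = c (Suc i) \<and> (\<forall>j<l. R (p j) (p (Suc j))) \<and>
             (\<exists>j<l. F (p j))"
  shows "\<exists>r. r 0 = c 0 \<and> (\<forall>n. R (r n) (r (Suc n))) \<and> (\<exists>\<^sub>\<infinity>n. F (r n)) \<and> (\<forall>i. \<exists>n. r n = c i)"
proof -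
  obtain l p where p0: "\<And>i. p i 0 = c i" and pl: "\<And>i. p i (l i) = c (Suc i)"
    and pR: "\<And>i j. j < l i \<Longrightarrow> R (p i j) (p i (Suc j))"
    and pF: "\<And>i. \<exists>j<l i. F (p i j)"
    using assms by metis
  have lpos: "0 < l i" for i
    using pF[of i] by auto
  \<comment> \<open>\<open>st n\<close> is the piece and the offset in it at time \<open>n\<close>.
    The last element of a piece is skipped, since it is the first of the next.\<close>
  define st where "st n = ((\<lambda>(i, j). if Suc j < l i then (i, Suc j) else (Suc i, 0)) ^^ n) (0, 0)"
    for n :: nat
  have st0: "st 0 = (0, 0)"
    by (simp add: st_def)
  have stS: "st (Suc n) = (case st n of (i, j) \<Rightarrow> if Suc j < l i then (i, Suc j) else (Suc i, 0))"
    for n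
    by (simp add: st_def)
  define r where "r n = (case st n of (i, j) \<Rightarrow> p i j)" for n
  have inv: "snd (st n) < l (fst (st n))" for n
    by (induction n) (auto simp: st0 stS lpos split: prod.splits)
  have rR: "R (r n) (r (Suc n))" for n
  proof (cases "st n")
    case (Pair i j)
    then have j: "j < l i"
      using inv[of n] by simp
    show ?thesis
    proof (cases "Suc j < l i")
      case False
      then have "Suc j = l i"
        using j by simp
      then show ?thesis
        using pR[OF j] False by (simp add: r_def stS Pair p0 pl)
    qed (use pR[OF j] in \<open>simp add: r_def stS Pair\<close>)
  qed
  have within: "st (n + j) = (i, j)" if "st n = (i, 0)" "j < l i" for n i j
    using that(2) by (induction j) (auto simp: that(1) stS)
  \<comment> \<open>The bound \<open>n \<ge> i\<close> is carried along so that the visits to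
    \<open>F\<close> occur arbitrarily late.\<close>
  have ex: "\<exists>n\<ge>i. st n = (i, 0)" for i
  proof (induction i)
    case (Suc i)
    then obtain n where n: "n \<ge> i" "st n = (i, 0)" by blast
    obtain k where k: "l i = Suc k"
      using lpos[of i] gr0_implies_Suc by blast
    have "st (n + k) = (i, k)"
      by (rule within[OF n(2)]) (simp add: k)
    then have "st (Suc (n + k)) = (Suc i, 0)"
      by (simp add: stS k)
    then show ?case
      using n(1) by (intro exI[of _ "Suc (n + k)"]) simp
  qed (use st0 in auto)
  show ?thesis
  proof (intro exI[of _ r] conjI allI)
    show "r 0 = c 0"
      by (simp add: r_def st0 p0)
    show "R (r n) (r (Suc n))" for n
      by (rule rR)
    show "\<exists>n. r n = c i" for i
    proof -
      obtain n where "st n = (i, 0)"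
        using ex by blast
      then have "r n = c i"
        by (simp add: r_def p0)
      then show ?thesis
        by blast
    qed
    show "\<exists>\<^sub>\<infinity>n. F (r n)"
      unfolding INFM_nat_le
    proof
      fix i
      obtain n where n: "n \<ge> i" "st n = (i, 0)"
        using ex by blast
      obtain j where "j < l i" "F (p i j)"
        using pF by blast
      then show "\<exists>n\<ge>i. F (r n)"
        using n within[OF n(2)] by (intro exI[of _ "n + j"]) (simp add: r_def)
    qed
  qed
qed

lemma pda_language_iff:
  assumes "finite (p_final M)"
  shows "w \<in> pda_language M \<longleftrightarrow> (\<exists>r. pda_run M w r \<and> (\<exists>\<^sub>\<infinity>n. fst (r n) \<in> p_final M))"
proof -
  have "limit (fst \<circ> r) \<inter> p_final M \<noteq> {} \<longleftrightarrow> (\<exists>\<^sub>\<infinity>n. fst (r n) \<in> p_final M)" for r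
    using fin_ex_inf_eq_limit[OF assms, of "fst \<circ> r"] by simp
  then show ?thesis
    unfolding pda_language_def by blast
qed

text \<open>The labels \<open>W i\<close>, laid end to end, form \<open>x\<close>. Since they are
  nonempty, the glued run reads all of \<open>x\<close>; the flags True supply the final
  states.\<close>

lemma pda_language_from_paths:
  assumes "finite (p_final M)" and "c 0 = (p_initial M, [p_bottom M])"
    and path: "\<And>i. pda_path M True (c i) (W i) (c (Suc i))"
    and ne: "\<And>i. W i \<noteq> []"
    and x: "\<And>i m. m < length (W i) \<Longrightarrow> x ((\<Sum>j<i. length (W j)) + m) = W i ! m"
  shows "x \<in> pda_language M"
proof -
  define N where "N i = (\<Sum>j<i. length (W j))" for i
  have NS: "N (Suc i) = N i + length (W i)" for i
    by (simp add: N_def)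
  have Nge: "i \<le> N i" for i
  proof (induction i)
    case (Suc i)
    moreover have "length (W i) > 0"
      using ne by simp
    ultimately show ?case
      unfolding NS by linarith
  qed simp
  define C where "C i = (fst (c i), N i, snd (c i))" for i
  have steps: "\<exists>l p. p 0 = C i \<and> p l = C (Suc i) \<and> (\<forall>j<l. pda_step M x (p j) (p (Suc j))) \<and>
      (\<exists>j<l. fst (p j) \<in> p_final M)" for i
    using pda_path_steps[OF path[of i], of x "N i"] x[of _ i] by (simp add: C_def NS N_def)
  obtain r where r: "r 0 = C 0" "\<And>n. pda_step M x (r n) (r (Suc n))"
    "\<exists>\<^sub>\<infinity>n. fst (r n) \<in> p_final M" "\<And>i. \<exists>n. r n = C i"
    using glue_paths[of C "pda_step M x" "\<lambda>c. fst c \<in> p_final M", OF steps] by blast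
  have "\<exists>n. i \<le> fst (snd (r n))" for i
    using r(4)[of i] Nge[of i] unfolding C_def by (metis fst_conv snd_conv)
  then have "pda_run M x r"
    using r(1,2) assms(2) by (simp add: pda_run_def C_def N_def)
  then show ?thesis
    using pda_language_iff[OF assms(1)] r(3) by blast
qed

section \<open>Cutting an accepting run into factors\<close>

lemma pda_step_position:
  assumes "\<And>n. pda_step M w (r n) (r (Suc n))"
  shows "mono (\<lambda>n. fst (snd (r n)))"
  unfolding mono_iff_le_Suc
proof
  fix n
  show "fst (snd (r n)) \<le> fst (snd (r (Suc n)))"
    using assms[of n] by cases auto
qed

text \<open>A converse to framing: \<open>A m\<close> is never empty, so no step touches
  \<open>\<gamma>\<close> and the segment is also a path on the stacks \<open>A m\<close>
  alone.\<close>

lemma pda_path_run_segment: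
  assumes step: "\<And>n. pda_step M w (r n) (r (Suc n))"
    and stack: "\<And>m. t \<le> m \<Longrightarrow> A m \<noteq> [] \<and> snd (snd (r m)) = A m @ \<gamma>"
    and "t \<le> t'"
  shows "pda_path M (\<exists>m\<in>{t..<t'}. fst (r m) \<in> p_final M) (fst (r t), A t)
           (subsequence w (fst (snd (r t))) (fst (snd (r t')))) (fst (r t'), A t')"
  using \<open>t \<le> t'\<close>
proof (induction t' rule: dec_induct)
  case base
  show ?case by (simp add: pda_path.empty)
next
  case (step n)
  let ?pos = "\<lambda>n. fst (snd (r n))"
  have le: "?pos t \<le> ?pos n"
    using pda_step_position[of M w r, OF assms(1)] step.hyps(1) by (simp add: mono_def)
  have A: "A n \<noteq> []" "snd (snd (r n)) = A n @ \<gamma>" "snd (snd (r (Suc n))) = A (Suc n) @ \<gamma>"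
    using stack[of n] stack[of "Suc n"] step.hyps(1) by auto
  have "pda_path M (fst (r n) \<in> p_final M) (fst (r n), A n)
      (subsequence w (?pos n) (?pos (Suc n))) (fst (r (Suc n)), A (Suc n)) \<and>
      ?pos (Suc n) \<in> {?pos n, Suc (?pos n)}"
    using assms(1)[of n]
  proof cases
    case (read q i Z q' \<alpha> \<gamma>')
    then obtain A' where "A n = Z # A'" "\<gamma>' = A' @ \<gamma>"
      using A by (cases "A n") auto
    then show ?thesis
      using read A(3) pda_path.read[OF read(3) pda_path.empty, of A'] by simp
  next
    case (silent q Z q' \<alpha> i \<gamma>')
    then obtain A' where "A n = Z # A'" "\<gamma>' = A' @ \<gamma>"
      using A by (cases "A n") auto
    then show ?thesis
      using silent A(3) pda_path.silent[OF silent(3) pda_path.empty, of A'] by simp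
  qed
  moreover from this have "subsequence w (?pos t) (?pos (Suc n)) =
      subsequence w (?pos t) (?pos n) @ subsequence w (?pos n) (?pos (Suc n))"
    using le by auto
  moreover have "(\<exists>m\<in>{t..<Suc n}. fst (r m) \<in> p_final M) \<longleftrightarrow>
      (\<exists>m\<in>{t..<n}. fst (r m) \<in> p_final M) \<or> fst (r n) \<in> p_final M"
    using step.hyps(1) by (auto simp: less_Suc_eq)
  ultimately show ?case
    using pda_path_append[OF step.IH] by simp
qed

text \<open>The positions \<open>p i\<close> come from times at which the stack below the top symbol is never touched
  again; among these, one pair of state and top symbol recurs infinitely often.\<close>

lemma pda_language_decomposition:
  assumes M: "pushdown_automaton M" and w: "w \<in> pda_language M"
  obtains p :: "nat \<Rightarrow> nat" and b q Z \<gamma> where "strict_mono p"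
    "pda_path M b (p_initial M, [p_bottom M]) (prefix (p 0) w) (q, Z # \<gamma>)"
    "\<And>i. \<exists>\<delta>. pda_path M True (q, [Z]) (subsequence w (p i) (p (Suc i))) (q, Z # \<delta>)"
proof -
  have "finite (p_final M)"
    using M finite_subset by (auto simp: pushdown_automaton_def)
  then obtain r where run: "pda_run M w r" and inf: "\<exists>\<^sub>\<infinity>n. fst (r n) \<in> p_final M"
    using w pda_language_iff by blast
  have r0: "r 0 = (p_initial M, 0, [p_bottom M])"
    and step: "\<And>n. pda_step M w (r n) (r (Suc n))"
    and unbounded: "\<And>i. \<exists>n. i \<le> fst (snd (r n))"
    using run by (auto simp: pda_run_def)
  define pos where "pos n = fst (snd (r n))" for n
  define stk where "stk n = snd (snd (r n))" for n
  have mono: "pos m \<le> pos n" if "m \<le> n" for m n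
    using pda_step_position[of M w r, OF step] that by (simp add: mono_def pos_def)
  have ne: "stk n \<noteq> []" for n
    using step[of n] by cases (auto simp: stk_def)
  \<comment> \<open>\<open>S\<close> collects the times after which the stack never gets lower. The
    least stack height from \<open>N\<close> on is attained, so \<open>S\<close> is
    unbounded.\<close>
  define S where "S = {n. \<forall>m\<ge>n. length (stk n) \<le> length (stk m)}"
  have "\<exists>n\<ge>N. n \<in> S" for N
  proof -
    obtain n where "n \<ge> N" "\<And>m. m \<ge> N \<Longrightarrow> length (stk n) \<le> length (stk m)"
      using ex_has_least_nat[of "\<lambda>n. n \<ge> N" N "\<lambda>n. length (stk n)"] by auto
    then show ?thesis
      by (auto simp: S_def)
  qed
  then have "infinite S"
    by (simp add: infinite_nat_iff_unbounded_le)
  have untouched: "\<exists>\<alpha>. \<alpha> \<noteq> [] \<and> stk m = \<alpha> @ tl (stk n)" if "n \<in> S" "n \<le> m" for n m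
    using that(2)
  proof (induction m rule: dec_induct)
    case base
    show ?case
      using ne[of n] by (intro exI[of _ "[hd (stk n)]"]) simp
  next
    case (step m)
    then obtain \<alpha> where \<alpha>: "\<alpha> \<noteq> []" "stk m = \<alpha> @ tl (stk n)" by blast
    obtain Z \<beta> \<sigma> where "stk m = Z # \<sigma>" "stk (Suc m) = \<beta> @ \<sigma>"
      using \<open>pda_step M w (r m) (r (Suc m))\<close> by cases (auto simp: stk_def)
    then have eq: "stk (Suc m) = (\<beta> @ tl \<alpha>) @ tl (stk n)"
      using \<alpha> by (cases \<alpha>) auto
    have "length (stk n) \<le> length (stk (Suc m))"
      using that(1) step.hyps(1) by (simp add: S_def)
    moreover have "length (tl (stk n)) < length (stk n)"
      using ne[of n] by simp
    ultimately have "\<beta> @ tl \<alpha> \<noteq> []"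
      unfolding eq by (metis append_Nil leD)
    then show ?case
      using eq by blast
  qed
  define top where "top n = (fst (r n), hd (stk n))" for n
  \<comment> \<open>Every configuration of the run has a successor, so its state and top symbol
    occur in one of the finitely many transitions.\<close>
  have "top n \<in> (\<lambda>(q, x, Z, q', \<alpha>). (q, Z)) ` p_trans M" for n
    using step[of n] by cases (force simp: top_def stk_def)+
  then have "finite (top ` S)"
    using M finite_subset[of "top ` S" "(\<lambda>(q, x, Z, q', \<alpha>). (q, Z)) ` p_trans M"]
    by (auto simp: pushdown_automaton_def)
  then obtain n0 where n0: "infinite {n \<in> S. top n = top n0}"
    using pigeonhole_infinite[OF \<open>infinite S\<close>] by blast
  define T where "T = {n \<in> S. top n = top n0}"
  obtain q Z where qZ: "top n0 = (q, Z)" by fastforce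
  have T: "n \<in> S" "fst (r n) = q" "stk n = Z # tl (stk n)" if "n \<in> T" for n
    using that qZ ne[of n] by (cases "stk n"; auto simp: T_def top_def)+
  \<comment> \<open>The next time in \<open>T\<close> is taken so late that a letter is read and a
    final state is left in between.\<close>
  have "\<exists>n'. n' \<in> T \<and> n < n' \<and> pos n < pos n' \<and> (\<exists>m\<in>{n..<n'}. fst (r m) \<in> p_final M)" for n
  proof -
    obtain m where m: "m > n" "fst (r m) \<in> p_final M"
      using inf unfolding INFM_nat by blast
    obtain m' where m': "Suc (pos n) \<le> pos m'"
      using unbounded pos_def by metis
    obtain n' where n': "n' > max m m'" "n' \<in> T"
      using n0 unfolding T_def infinite_nat_iff_unbounded by blast
    then have "pos m' \<le> pos n'"
      by (intro mono) simp
    then show ?thesis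
      using m m' n' by (intro exI[of _ n']) (auto intro!: bexI[of _ m])
  qed
  moreover have "\<exists>n. n \<in> T"
    using n0 by (metis T_def finite.emptyI ex_in_conv)
  ultimately obtain t where tT: "\<And>i. t i \<in> T" and t: "\<And>i. t i < t (Suc i)"
      "\<And>i. pos (t i) < pos (t (Suc i))"
      "\<And>i. \<exists>m\<in>{t i..<t (Suc i)}. fst (r m) \<in> p_final M"
    using dependent_nat_choice[of "\<lambda>_ n. n \<in> T" "\<lambda>_ n n'. n < n' \<and> pos n < pos n' \<and>
      (\<exists>m\<in>{n..<n'}. fst (r m) \<in> p_final M)"] by blast
  show ?thesis
  proof
    show "strict_mono (\<lambda>i. pos (t i))"
      using t(2) by (simp add: strict_mono_Suc_iff)
    show "pda_path M (\<exists>m\<in>{0..<t 0}. fst (r m) \<in> p_final M) (p_initial M, [p_bottom M])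
        (prefix (pos (t 0)) w) (q, Z # tl (stk (t 0)))"
      using pda_path_run_segment[of M w r, OF step, of 0 stk "[]" "t 0"] ne r0 T[OF tT[of 0]]
      by (simp add: stk_def pos_def)
    show "\<exists>\<delta>. pda_path M True (q, [Z]) (subsequence w (pos (t i)) (pos (t (Suc i))))
            (q, Z # \<delta>)" for i
    proof -
      let ?\<gamma> = "tl (stk (t i))"
      obtain A where A: "\<And>m. t i \<le> m \<Longrightarrow> A m \<noteq> [] \<and> stk m = A m @ ?\<gamma>"
        using untouched[OF T(1)[OF tT[of i]]] by metis
      \<comment> \<open>Both times have top symbol \<open>Z\<close>. At \<open>t i\<close> only
        \<open>?\<gamma>\<close> lies below it; at \<open>t (Suc i)\<close> the part above
        \<open>?\<gamma>\<close> is nonempty, so \<open>Z\<close> is its head.\<close>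
      have "A (t i) = [Z]"
        using A[of "t i"] T(3)[OF tT[of i]]
        by (metis append_Cons append_Nil append_same_eq order_refl)
      moreover obtain \<delta> where "A (t (Suc i)) = Z # \<delta>"
        using A[of "t (Suc i)"] T(3)[OF tT[of "Suc i"]] t(1)[of i]
        by (cases "A (t (Suc i))") auto
      moreover have "pda_path M True (fst (r (t i)), A (t i))
          (subsequence w (pos (t i)) (pos (t (Suc i)))) (fst (r (t (Suc i))), A (t (Suc i)))"
      proof -
        have "A m \<noteq> [] \<and> snd (snd (r m)) = A m @ ?\<gamma>" if "t i \<le> m" for m
          using A[OF that] unfolding stk_def .
        from pda_path_run_segment[of M w r, OF step this less_imp_le[OF t(1)[of i]]]
        show ?thesis
          using t(3)[of i] by (simp add: pos_def)
      qed
      ultimately show ?thesis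
        using T(2)[OF tT] by auto
    qed
  qed
qed

section \<open>Ultimately periodic words and the pumping lemma\<close>

definition ultimately_periodic :: "'a word \<Rightarrow> bool" where
  "ultimately_periodic w \<longleftrightarrow> (\<exists>i p. p > 0 \<and> (\<forall>n\<ge>i. w (n + p) = w n))"

text \<open>Such a word is determined by \<open>i\<close>, \<open>p\<close> and its prefix of length
  \<open>i + p\<close>, and these range over a countable type.\<close>

lemma countable_ultimately_periodic:
  "countable {w :: 'a :: countable word. ultimately_periodic w}"
proof -
  define f where "f = (\<lambda>(xs, i, p). \<lambda>n. xs ! (if n < i then n else i + (n - i) mod p) :: 'a)"
  have "w \<in> range f" if "ultimately_periodic w" for w
  proof -
    obtain i p where p: "p > 0" "\<And>n. n \<ge> i \<Longrightarrow> w (n + p) = w n"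
      using \<open>ultimately_periodic w\<close> by (auto simp: ultimately_periodic_def)
    have per: "w (i + m + k * p) = w (i + m)" for m k
    proof (induction k)
      case (Suc k)
      then show ?case
        using p(2)[of "i + m + k * p"] by (simp add: algebra_simps)
    qed simp
    have "w n = f (prefix (i + p) w, i, p) n" for n
    proof (cases "n < i")
      case False
      then have "w n = w (i + (n - i) mod p + ((n - i) div p) * p)"
        by simp
      also have "\<dots> = w (i + (n - i) mod p)"
        by (rule per)
      finally show ?thesis
        using False p(1) by (simp add: f_def)
    qed (simp add: f_def)
    then show ?thesis
      by blast
  qed
  then have "{w. ultimately_periodic w} \<subseteq> range f"
    by blast
  then show ?thesis
    by (rule countable_subset) simp
qed

text \<open>The first factor \<open>?x\<close> commutes with every factor, hence with every product
  of the factors after it. So \<open>w\<close> read from \<open>p 0\<close> and from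
  \<open>p (Suc 0)\<close> agree on ever longer stretches: a shift by the length of
  \<open>?x\<close> changes nothing.\<close>

lemma ultimately_periodic_if_commuting:
  assumes p: "strict_mono p"
    and comm: "\<And>i. subsequence w (p 0) (p (Suc 0)) @ subsequence w (p i) (p (Suc i)) =
                    subsequence w (p i) (p (Suc i)) @ subsequence w (p 0) (p (Suc 0))"
  shows "ultimately_periodic w"
proof -
  let ?x = "subsequence w (p 0) (p (Suc 0))"
  define L where "L = p (Suc 0) - p 0"
  have mono: "p i \<le> p j" if "i \<le> j" for i j
    using p that by (simp add: strict_mono_less_eq)
  have split: "subsequence w i k = subsequence w i j @ subsequence w j k"
    if "i \<le> j" "j \<le> k" for i j k
    using that by (intro nth_equalityI) (auto simp: nth_append add.commute)
  have "?x @ subsequence w (p (Suc 0)) (p (Suc m)) = subsequence w (p (Suc 0)) (p (Suc m)) @ ?x"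
    for m
  proof (induction m)
    case (Suc m)
    have "subsequence w (p (Suc 0)) (p (Suc (Suc m))) =
        subsequence w (p (Suc 0)) (p (Suc m)) @ subsequence w (p (Suc m)) (p (Suc (Suc m)))"
      by (intro split mono) auto
    then show ?case
      using Suc comm[of "Suc m"] by (metis append_assoc)
  qed simp
  moreover have "?x @ subsequence w (p (Suc 0)) (p (Suc m)) = subsequence w (p 0) (p (Suc m))" for m
    by (intro split[symmetric] mono) auto
  ultimately have eq:
    "subsequence w (p 0) (p (Suc m)) = subsequence w (p (Suc 0)) (p (Suc m)) @ ?x" for m
    by metis
  have "L > 0"
    using p by (simp add: L_def strict_mono_def)
  moreover have "w (n + L) = w n" if "n \<ge> p 0" for n
  proof -
    obtain m where m: "n + L < p (Suc m)"
      using strict_mono_imp_increasing[OF p, of "Suc (n + L)"] by (meson Suc_le_eq)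
    have "p 0 \<le> p (Suc 0)"
      by (rule mono) simp
    \<comment> \<open>As \<open>p (Suc 0) = p 0 + L\<close>, both letters sit at offset
      \<open>n - p 0\<close> of the stretches compared in \<open>eq\<close>.\<close>
    then have "w n = subsequence w (p 0) (p (Suc m)) ! (n - p 0)"
      "w (n + L) = subsequence w (p (Suc 0)) (p (Suc m)) ! (n - p 0)"
      "n - p 0 < p (Suc m) - p (Suc 0)"
      using that m by (auto simp: L_def add.commute)
    then show ?thesis
      unfolding eq[of m] by (simp add: nth_append)
  qed
  ultimately show ?thesis
    unfolding ultimately_periodic_def by blast
qed

text \<open>Factors label loops from \<open>Z\<close> to \<open>Z\<close> that only add stack below,
  so they can be played in any order. The blocks are \<open>y @ z\<close> and \<open>z @ y\<close>,
  rather than \<open>y\<close> and \<open>z\<close>, to have equal length.\<close>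

lemma pda_language_pumping:
  fixes M :: "('q, 'a, 'g) pda"
  assumes M: "pushdown_automaton M" and w: "w \<in> pda_language M" "\<not> ultimately_periodic w"
  shows "\<exists>u v v'. length v = length v' \<and> v \<noteq> v' \<and>
    (\<forall>s. (\<forall>i. s i \<in> {v, v'}) \<longrightarrow>
         u \<frown> (\<lambda>n. s (n div length v) ! (n mod length v)) \<in> pda_language M)"
proof -
  obtain p :: "nat \<Rightarrow> nat" and b q Z \<gamma> where p: "strict_mono p"
    and u: "pda_path M b (p_initial M, [p_bottom M]) (prefix (p 0) w) (q, Z # \<gamma>)"
    and x: "\<And>i. \<exists>\<delta>. pda_path M True (q, [Z]) (subsequence w (p i) (p (Suc i))) (q, Z # \<delta>)"
    by (rule pda_language_decomposition[OF M w(1)]) (rule that)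
  define u where "u = prefix (p 0) w"
  define y where "y = subsequence w (p 0) (p (Suc 0))"
  obtain i where i: "y @ subsequence w (p i) (p (Suc i)) \<noteq> subsequence w (p i) (p (Suc i)) @ y"
    using ultimately_periodic_if_commuting[OF p] w(2) unfolding y_def by blast
  define z where "z = subsequence w (p i) (p (Suc i))"
  have loop: "\<exists>\<delta>. pda_path M True (q, [Z]) (xs @ ys) (q, Z # \<delta>)"
    if xs: "\<exists>\<delta>. pda_path M True (q, [Z]) xs (q, Z # \<delta>)"
      and ys: "\<exists>\<delta>. pda_path M True (q, [Z]) ys (q, Z # \<delta>)" for xs ys
  proof -
    obtain \<delta> \<delta>' where d: "pda_path M True (q, [Z]) xs (q, Z # \<delta>)"
      "pda_path M True (q, [Z]) ys (q, Z # \<delta>')"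
      using xs ys by blast
    show ?thesis
      using pda_path_append[OF d(1)] pda_path_frame[OF d(2), of \<delta>] by fastforce
  qed
  define v v' where "v = y @ z" and "v' = z @ y"
  have len: "length v = length v'" and neq: "v \<noteq> v'"
    using i by (auto simp: v_def v'_def z_def)
  have "\<forall>a\<in>{v, v'}. \<exists>\<delta>. pda_path M True (q, [Z]) a (q, Z # \<delta>)"
    using loop x by (auto simp: v_def v'_def y_def z_def)
  then obtain D where D: "\<And>a. a \<in> {v, v'} \<Longrightarrow> pda_path M True (q, [Z]) a (q, Z # D a)"
    by metis
  show ?thesis
  proof (rule exI[of _ u], rule exI[of _ v], rule exI[of _ v'], intro conjI len neq allI impI)
    fix s :: "nat \<Rightarrow> 'a list" assume "\<forall>i. s i \<in> {v, v'}"
    then have s: "s i \<in> {v, v'}" for i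
      by blast
    let ?L = "length v"
    have Ls: "length (s i) = ?L" for i
      using s[of i] len by auto
    have L: "?L > 0"
      using len neq by auto
    \<comment> \<open>\<open>G i\<close> is the stack below \<open>Z\<close> after block
      \<open>s i\<close>: each block leaves its \<open>D\<close> on top of what lay there.\<close>
    define G where "G = rec_nat (D (s 0) @ \<gamma>) (\<lambda>i g. D (s (Suc i)) @ g)"
    define c where "c = case_nat (p_initial M, [p_bottom M]) (\<lambda>i. (q, Z # G i))"
    \<comment> \<open>\<open>u\<close> is joined to the first block, because it may be empty and its
      path may meet no final state.\<close>
    define W where "W = case_nat (u @ s 0) (\<lambda>i. s (Suc i))"
    have frame: "pda_path M True (q, Z # \<beta>) (s i) (q, Z # D (s i) @ \<beta>)" for i \<beta>
      using pda_path_frame[OF D[OF s[of i]], of \<beta>] by simp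
    have sum: "(\<Sum>j<i. length (W j)) = (if i = 0 then 0 else length u + i * ?L)" for i
      by (induction i) (auto simp: W_def Ls split: nat.split)
    show "u \<frown> (\<lambda>n. s (n div ?L) ! (n mod ?L)) \<in> pda_language M"
    proof (rule pda_language_from_paths[of M c W])
      show "finite (p_final M)"
        using M finite_subset by (auto simp: pushdown_automaton_def)
      show "c 0 = (p_initial M, [p_bottom M])"
        by (simp add: c_def)
      show "pda_path M True (c i) (W i) (c (Suc i))" for i
      proof (cases i)
        case 0
        then show ?thesis
          using pda_path_append[OF u frame[of \<gamma> 0]] by (simp add: c_def W_def G_def u_def)
      next
        case (Suc j)
        then show ?thesis
          using frame[of "G j" "Suc j"] by (simp add: c_def W_def G_def)
      qed
      show "W i \<noteq> []" for i
        using L Ls by (cases i) (auto simp: W_def simp flip: length_greater_0_conv)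
      show "(u \<frown> (\<lambda>n. s (n div ?L) ! (n mod ?L))) ((\<Sum>j<i. length (W j)) + m) = W i ! m"
        if "m < length (W i)" for i m
      proof (cases i)
        case 0
        then show ?thesis
          using that by (auto simp: W_def Ls conc_def nth_append)
      next
        case (Suc j)
        then have m: "m < ?L"
          using that by (simp add: W_def Ls)
        have "(i * ?L + m) div ?L = i" "(i * ?L + m) mod ?L = m"
          using m L by (simp_all only: div_mult_self3 mod_mult_self3) simp_all
        moreover have "(\<Sum>j<i. length (W j)) + m = length u + (i * ?L + m)"
          unfolding sum using Suc by simp
        moreover have "(u \<frown> f) (length u + n) = f n" for f n
          by simp
        moreover have "W i = s i"
          by (simp add: W_def Suc)
        ultimately show ?thesis
          by presburger
      qed
    qed
  qed
qed

section \<open>Homogeneous sets\<close>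

text \<open>A pushdown automaton has a single initial state; here this is \<open>0\<close>, from which a silent move
  chooses one of the initial states of the Buechi automaton, shifted by one.\<close>

lemma omega_context_free_if_omega_regular:
  assumes "omega_regular L"
  shows "omega_context_free L"
proof -
  obtain M :: "(nat, 'a) buchi" where M: "buchi_automaton M" and L: "L = buchi_language M"
    using assms by (auto simp: omega_regular_def)
  define P :: "(nat, 'a, nat) pda" where
    "P = \<lparr>p_alphabet = b_alphabet M, p_states = insert 0 (Suc ` b_states M), p_stack = {0},
          p_initial = 0, p_bottom = 0,
          p_trans = (\<lambda>q. (0, None, 0, Suc q, [0])) ` b_initial M \<union>
            (\<lambda>(q, a, q'). (Suc q, Some a, 0, Suc q', [0])) ` b_trans M,
          p_final = Suc ` b_final M\<rparr>"
  have fin: "finite (b_initial M)" "finite (b_final M)" "finite (b_trans M)"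
    using M finite_subset[of "b_trans M" "b_states M \<times> b_alphabet M \<times> b_states M"] finite_subset
    by (auto simp: buchi_automaton_def)
  have P: "pushdown_automaton P"
    using M fin by (fastforce simp: pushdown_automaton_def buchi_automaton_def P_def)
  have finP: "finite (p_final P)"
    using fin by (simp add: P_def)
  have "buchi_language M = pda_language P"
  proof (intro set_eqI iffI)
    fix w assume "w \<in> buchi_language M"
    then obtain r where r: "buchi_run M w r" "\<exists>\<^sub>\<infinity>n. r n \<in> b_final M"
      using buchi_language_iff[OF fin(2)] by blast
    \<comment> \<open>The silent move takes one step, so at time \<open>Suc n\<close> the state is
      the shifted \<open>r n\<close> and \<open>n\<close> letters have been read.\<close>
    define r' where "r' = case_nat (0, 0, [0]) (\<lambda>n. (Suc (r n), n, [0::nat]))"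
    have "pda_step P w (r' n) (r' (Suc n))" for n
    proof (cases n)
      case 0
      have "(0, None, 0, Suc (r 0), [0]) \<in> p_trans P"
        using r(1) by (simp add: buchi_run_def P_def)
      then show ?thesis
        using pda_step.silent[of 0 0 "Suc (r 0)" "[0]" P w 0 "[]"] by (simp add: r'_def 0)
    next
      case (Suc m)
      have "(Suc (r m), Some (w m), 0, Suc (r (Suc m)), [0]) \<in> p_trans P"
        using r(1) by (force simp: buchi_run_def P_def)
      then show ?thesis
        using pda_step.read[of "Suc (r m)" w m 0 "Suc (r (Suc m))" "[0]" P "[]"]
        by (simp add: r'_def Suc)
    qed
    moreover have "i \<le> fst (snd (r' (Suc i)))" for i
      by (simp add: r'_def)
    moreover have "r' 0 = (p_initial P, 0, [p_bottom P])"
      by (simp add: r'_def P_def)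
    ultimately have "pda_run P w r'"
      unfolding pda_run_def by blast
    moreover have "\<exists>\<^sub>\<infinity>n. fst (r' n) \<in> p_final P"
      unfolding INFM_nat_le
    proof
      fix n
      obtain m where "m \<ge> n" "r m \<in> b_final M"
        using r(2) unfolding INFM_nat_le by blast
      then show "\<exists>m\<ge>n. fst (r' m) \<in> p_final P"
        by (intro exI[of _ "Suc m"]) (simp add: r'_def P_def)
    qed
    ultimately show "w \<in> pda_language P"
      using pda_language_iff[OF finP] by blast
  next
    fix w assume "w \<in> pda_language P"
    then obtain r where run: "pda_run P w r" and inf: "\<exists>\<^sub>\<infinity>n. fst (r n) \<in> p_final P"
      using pda_language_iff[OF finP] by blast
    have r0: "r 0 = (0, 0, [0])" and step: "\<And>n. pda_step P w (r n) (r (Suc n))"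
      using run by (auto simp: pda_run_def P_def)
    have first: "\<exists>q\<in>b_initial M. r (Suc 0) = (Suc q, 0, [0])"
      using step[of 0] unfolding r0 by cases (auto simp: P_def)
    have succ: "\<exists>q'. (q, w i, q') \<in> b_trans M \<and> r (Suc n) = (Suc q', Suc i, [0])"
      if "r n = (Suc q, i, [0])" for n q i
      using step[of n] unfolding that by cases (auto simp: P_def)
    \<comment> \<open>No transition returns to \<open>0\<close>, so only the first move is
      silent.\<close>
    have form: "\<exists>q. r (Suc n) = (Suc q, n, [0])" for n
      by (induction n) (use first succ in blast)+
    then obtain s where s: "\<And>n. r (Suc n) = (Suc (s n), n, [0])"
      by metis
    have "buchi_run M w s"
      using first succ[OF s] s unfolding buchi_run_def by auto
    moreover have "\<exists>\<^sub>\<infinity>n. s n \<in> b_final M"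
      unfolding INFM_nat_le
    proof
      fix n
      obtain m where "m > n" "fst (r m) \<in> p_final P"
        using inf unfolding INFM_nat by blast
      then obtain m' where "m = Suc m'" "m' \<ge> n" "fst (r (Suc m')) \<in> p_final P"
        by (cases m) auto
      then show "\<exists>m\<ge>n. s m \<in> b_final M"
        using s[of m'] by (auto simp: P_def)
    qed
    ultimately show "w \<in> buchi_language M"
      using buchi_language_iff[OF fin(2)] by blast
  qed
  then show ?thesis
    unfolding omega_context_free_def using P L by blast
qed

lemma not_homogeneous_ee_class:
  fixes H :: "'a :: countable word set"
  assumes "omega_context_free H" and "uncountable H" and k: "k \<ge> 2"
  shows "\<not> homogeneous k l V (ee_class V k) H"
proof
  assume hom: "homogeneous k l V (ee_class V k) H"
  obtain M :: "(nat, 'a, nat) pda" where M: "pushdown_automaton M" and H: "H = pda_language M"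
    using assms(1) by (auto simp: omega_context_free_def)
  obtain w where w: "w \<in> pda_language M" "\<not> ultimately_periodic w"
    using assms(2) H countable_subset[OF _ countable_ultimately_periodic, of H] by blast
  obtain u v v' where len: "length v = length v'" and neq: "v \<noteq> v'"
    and pump: "\<And>s. (\<And>i. s i \<in> {v, v'}) \<Longrightarrow>
         u \<frown> (\<lambda>n. s (n div length v) ! (n mod length v)) \<in> pda_language M"
    using pda_language_pumping[OF M w] by metis
  obtain d where d: "d < length v" "v ! d \<noteq> v' ! d"
    using len neq by (auto simp: list_eq_iff_nth_eq)
  \<comment> \<open>\<open>f\<close> chooses between \<open>v\<close> and \<open>v'\<close> for each
    block.\<close>
  define e where
    "e f = u \<frown> (\<lambda>n. (if f (n div length v) then v else v') ! (n mod length v))"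
    for f :: "nat \<Rightarrow> bool"
  have eH: "e f \<in> H" for f
    unfolding e_def H by (rule pump[of "\<lambda>i. if f i then v else v'"]) simp
  have differ: "e f (length u + (i * length v + d)) \<noteq> e g (length u + (i * length v + d))"
    if "f i \<noteq> g i" for f g i
  proof -
    have "(i * length v + d) div length v = i"
      using d(1) by (subst div_mult_self3) auto
    then show ?thesis
      using that d by (auto simp: e_def conc_def)
  qed
  have "inj e"
  proof (rule injI, rule ccontr)
    fix f g assume eq: "e f = e g" and "f \<noteq> g"
    then obtain i where "f i \<noteq> g i" by blast
    then show False
      using differ[of f i g] eq by simp
  qed
  have ee: "eventually_equal (e f) (e g)" if fg: "\<And>i. i \<ge> N \<Longrightarrow> f i = g i" for f g N
  proof -
    have "e f n = e g n" if "n \<ge> length u + N * length v" for n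
    proof -
      have "N * length v \<le> n - length u"
        using that by simp
      then have "N \<le> (n - length u) div length v"
        using d(1) div_le_mono[of "N * length v" "n - length u" "length v"]
        by (subst (asm) nonzero_mult_div_cancel_right) auto
      then show ?thesis
        using fg that by (simp add: e_def conc_def)
    qed
    then show ?thesis
      unfolding eventually_equal_def MOST_nat_le by blast
  qed
  \<comment> \<open>\<open>S\<close> consists of the indicators of single numbers below
    \<open>k\<close>, all False from \<open>k\<close> on. In \<open>S'\<close> one of them is traded
    for the constant True; as \<open>k \<ge> 2\<close>, the indicator of 0 remains.\<close>
  define S where "S = (\<lambda>j i. i = (j::nat)) ` {..<k}"
  define S' where "S' = insert (\<lambda>_. True) ((\<lambda>j i. i = (j::nat)) ` {..<k - 1})"
  have inj: "inj (\<lambda>j i. i = (j::nat))"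
    by (auto simp: inj_def fun_eq_iff)
  have fin: "finite S" "finite S'"
    by (simp_all add: S_def S'_def)
  have "card S = k"
    by (simp add: S_def card_image inj_on_subset[OF inj])
  moreover have "(\<lambda>_. True) \<notin> range (\<lambda>j i. i = (j::nat))"
    by (auto simp: fun_eq_iff) presburger
  then have "card S' = k"
    using k by (subst S'_def, subst card_insert_disjoint)
      (auto simp: card_image inj_on_subset[OF inj])
  ultimately have "e ` S \<in> nsets H k" "e ` S' \<in> nsets H k"
    using eH fin by (auto simp: nsets_def card_image inj_on_subset[OF \<open>inj e\<close>])
  then obtain i where i: "e ` S \<in> ee_class V k i" "e ` S' \<in> ee_class V k i"
    using hom by (auto simp: homogeneous_def)
  have "eventually_equal x y" if "x \<in> e ` S" "y \<in> e ` S" for x y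
    using that by (auto simp: S_def intro!: ee[of k])
  moreover have "\<not> eventually_equal (e (\<lambda>_. True)) (e (\<lambda>i. i = 0))"
  proof
    assume "eventually_equal (e (\<lambda>_. True)) (e (\<lambda>i. i = 0))"
    then obtain m where m: "\<And>n. n \<ge> m \<Longrightarrow> e (\<lambda>_. True) n = e (\<lambda>i. i = 0) n"
      unfolding eventually_equal_def MOST_nat_le by blast
    \<comment> \<open>Block \<open>Suc m\<close> starts no earlier than \<open>m\<close>, and its
      number is not 0, so the two choices differ there.\<close>
    have "m \<le> Suc m * length v"
      using d(1) by (cases "length v") auto
    then show False
      using differ[of "\<lambda>_. True" "Suc m" "\<lambda>i. i = 0"] m by auto
  qed
  moreover have "e (\<lambda>_. True) \<in> e ` S'" "e (\<lambda>i. i = 0) \<in> e ` S'"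
    using k by (auto simp: S'_def)
  ultimately show False
    using i unfolding ee_class_def by (auto split: if_splits)
qed

lemma uncountable_if_natLeq_less:
  assumes "natLeq <o lam" and "|A| =o lam"
  shows "uncountable A"
  using assms countable_card_le_natLeq not_ordLess_ordLeq ordIso_symmetric ordLess_ordIso_trans
  by metis

theorem theorem3p13:
  fixes k l :: nat and lam :: "'c rel"
  assumes "k \<ge> 2" and "l \<ge> 2"
    and "Card_order lam" and "natLeq <o lam"
  shows "\<exists>(V :: nat word set) (E :: nat \<Rightarrow> nat word set set)
            (L :: nat word set) (h :: nat word \<Rightarrow> nat word).
           kl_partition k l V E \<and> |V| =o ctwo ^c natLeq \<and>
           injective_omega_automatic_presentation k l V E L h \<and>
           \<not> (\<exists>H \<subseteq> L. omega_context_free H \<and> homogeneous k l V E (h ` H) \<and> |h ` H| =o lam) \<and>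
           \<not> (\<exists>H \<subseteq> L. omega_regular H \<and> homogeneous k l V E (h ` H) \<and> |h ` H| =o lam)"
proof -
  \<comment> \<open>The words are their own vertices: \<open>L\<close> is also the vertex set and
    \<open>h\<close> is the identity.\<close>
  define L :: "nat word set" where "L = {w. \<forall>n. w n \<in> {0, 1}}"
  have no_context_free: "\<not> (\<exists>H \<subseteq> L. omega_context_free H \<and>
      homogeneous k l L (ee_class L k) (id ` H) \<and> |id ` H| =o lam)"
    using not_homogeneous_ee_class[OF _ uncountable_if_natLeq_less[OF assms(4)] assms(1)] by auto
  moreover have "injective_omega_automatic_presentation k l L (ee_class L k) L id"
    by (rule presentation_ee_class[of "{0, 1}"]) (simp_all add: L_def)
  moreover have "|L| =o ctwo ^c natLeq"
    unfolding L_def by (rule card_of_binary_words)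
  ultimately show ?thesis
    using kl_partition_ee_class[OF assms(2)] omega_context_free_if_omega_regular
    by (intro exI[of _ L] exI[of _ "ee_class L k"] exI[of _ id]) blast
qed

end
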